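(* Let $\succsim$ be a preference relation on $\mathcal X$ satisfying Axioms (RC), (M), (SRM) and (C). Then $\succsim$ satisfies Property (AN) if and only if the $\succsim$-matching probability $\nu$ is a (countably additive) probability measure on $\mathcal F$.
   Context: Setting. $(\Omega,\mathcal F)$ is a measurable space, $\mathcal G\subseteq\mathcal F$ is a sub-$\sigma$-algebra, and $\mathbb P:\mathcal G\to[0,1]$ is a (countably additive) probability measure that is atomless: $\{\mathbb P(B):B\in\mathcal G,\,B\subseteq A\}=[0,\mathbb P(A)]$ for every $A\in\mathcal G$. An act is a bounded $\mathcal F$-measurable function $X:\Omega\to\mathbb R$; $\mathcal X$ is the set of acts, $\mathcal X(\mathcal G)$ the set of $\mathcal G$-measurable acts. A preference relation $\succsim$ is a total preorder on $\mathcal X$; $\succ$ and $\simeq$ are its strict and symmetric parts. For $A,B\in\mathcal F$, $A\succsim B$ means $\mathbf 1_A\succsim\mathbf 1_B$ (similarly $\simeq$). Axioms. (RC) If $X,Y\in\mathcal X(\mathcal G)$ and $\mathbb P(X>x)=\mathbb P(Y>x)$ for all $x\in\mathbb R$, then $X\simeq Y$. (M) If $X,Y\in\mathcal X$ and $X(\omega)\ge Y(\omega)$ for all $\omega$, then $X\succsim Y$. (SRM) If $X,Y\in\mathcal X(\mathcal G)$, $\mathbb P(X\ge Y)=1$ and $\mathbb P(X>Y)>0$, then $X\succ Y$. (C) For all $X\in\mathcal X$, the sets $\{Y\in\mathcal X:X\succsim Y\}$ and $\{Y\in\mathcal X:Y\succsim X\}$ are B-closed, where $\mathcal S\subseteq\mathcal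 X$ is B-closed if whenever $(X_n)_{n\in\mathbb N}\subseteq\mathcal S$ satisfies $\sup_n\sup_\omega|X_n(\omega)|<\infty$ and $X_n\to X\in\mathcal X$ pointwise, then $X\in\mathcal S$. A $\succsim$-matching probability is a function $\nu:\mathcal F\to[0,1]$ such that for every $A\in\mathcal F$ there is $R_A\in\mathcal G$ with $\nu(A)=\mathbb P(R_A)$ and $A\simeq R_A$. Under (RC), (M), (SRM), (C) it exists and is unique. Property (AN), ambiguity neutrality: for all $A,B,C\in\mathcal F$ with $(A\cup B)\cap C=\varnothing$, $A\succsim B\iff A\cup C\succsim B\cup C$. *)

theory Defs
  imports "HOL-Probability.Probability"
begin

text \<open>
  A single measure \<open>P\<close> carries both the \<sigma>-algebra \<open>\<G> = sets P\<close> and the probability on it. The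
  larger measurable space \<open>(\<Omega>, \<F>)\<close> is given by a second measure \<open>F\<close>, of which only \<open>space F\<close> and
  \<open>sets F\<close> are ever used; \<open>subalgebra F P\<close> says that both have the same \<open>\<Omega>\<close> and \<open>\<G> \<subseteq> \<F>\<close>.
\<close>

definition atomless :: "'a measure \<Rightarrow> bool" where
  "atomless P \<longleftrightarrow>
     (\<forall>A\<in>sets P. {measure P B | B. B \<in> sets P \<and> B \<subseteq> A} = {0..measure P A})"

text \<open>
  \<open>acts F\<close> is the set of all acts and \<open>acts P\<close> the set of \<open>\<G>\<close>-measurable ones. Values of a function
  outside \<open>\<Omega>\<close> are unconstrained; axiom (M) below makes acts that agree on \<open>\<Omega>\<close> indifferent.
\<close>

definition acts :: "'a measure \<Rightarrow> ('a \<Rightarrow> real) set" where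
  "acts M = {X. X \<in> borel_measurable M \<and> bounded (X ` space M)}"

type_synonym 'a pref = "('a \<Rightarrow> real) \<Rightarrow> ('a \<Rightarrow> real) \<Rightarrow> bool"

definition preference :: "'a measure \<Rightarrow> 'a pref \<Rightarrow> bool" where
  "preference F R \<longleftrightarrow> reflp_on (acts F) R \<and> transp_on (acts F) R \<and> totalp_on (acts F) R"

definition strict_pref :: "'a pref \<Rightarrow> 'a pref" where
  "strict_pref R X Y \<longleftrightarrow> R X Y \<and> \<not> R Y X"

definition indiff :: "'a pref \<Rightarrow> 'a pref" where
  "indiff R X Y \<longleftrightarrow> R X Y \<and> R Y X"

definition event_pref :: "'a pref \<Rightarrow> 'a set \<Rightarrow> 'a set \<Rightarrow> bool" where
  "event_pref R A B \<longleftrightarrow> R (indicat_real A) (indicat_real B)"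

definition event_indiff :: "'a pref \<Rightarrow> 'a set \<Rightarrow> 'a set \<Rightarrow> bool" where
  "event_indiff R A B \<longleftrightarrow> indiff R (indicat_real A) (indicat_real B)"

definition axiom_RC :: "'a measure \<Rightarrow> 'a pref \<Rightarrow> bool" where
  "axiom_RC P R \<longleftrightarrow>
     (\<forall>X\<in>acts P. \<forall>Y\<in>acts P.
        (\<forall>x. \<P>(\<omega> in P. X \<omega> > x) = \<P>(\<omega> in P. Y \<omega> > x)) \<longrightarrow> indiff R X Y)"

definition axiom_M :: "'a measure \<Rightarrow> 'a pref \<Rightarrow> bool" where
  "axiom_M F R \<longleftrightarrow>
     (\<forall>X\<in>acts F. \<forall>Y\<in>acts F. (\<forall>\<omega>\<in>space F. X \<omega> \<ge> Y \<omega>) \<longrightarrow> R X Y)"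

definition axiom_SRM :: "'a measure \<Rightarrow> 'a pref \<Rightarrow> bool" where
  "axiom_SRM P R \<longleftrightarrow>
     (\<forall>X\<in>acts P. \<forall>Y\<in>acts P.
        \<P>(\<omega> in P. X \<omega> \<ge> Y \<omega>) = 1 \<and> \<P>(\<omega> in P. X \<omega> > Y \<omega>) > 0 \<longrightarrow> strict_pref R X Y)"

definition B_closed :: "'a measure \<Rightarrow> ('a \<Rightarrow> real) set \<Rightarrow> bool" where
  "B_closed F S \<longleftrightarrow>
     (\<forall>Xs X. (\<forall>n::nat. Xs n \<in> S) \<and> bounded (\<Union>n. Xs n ` space F) \<and> X \<in> acts F \<and>
        (\<forall>\<omega>\<in>space F. (\<lambda>n. Xs n \<omega>) \<longlonglongrightarrow> X \<omega>) \<longrightarrow> X \<in> S)"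

definition axiom_C :: "'a measure \<Rightarrow> 'a pref \<Rightarrow> bool" where
  "axiom_C F R \<longleftrightarrow>
     (\<forall>X\<in>acts F. B_closed F {Y \<in> acts F. R X Y} \<and> B_closed F {Y \<in> acts F. R Y X})"

definition matching_probability ::
    "'a measure \<Rightarrow> 'a measure \<Rightarrow> 'a pref \<Rightarrow> ('a set \<Rightarrow> real) \<Rightarrow> bool" where
  "matching_probability F P R \<nu> \<longleftrightarrow>
     (\<forall>A\<in>sets F. \<nu> A \<in> {0..1}) \<and>
     (\<forall>A\<in>sets F. \<exists>R\<^sub>A\<in>sets P. \<nu> A = measure P R\<^sub>A \<and> event_indiff R A R\<^sub>A)"

definition ambiguity_neutral :: "'a measure \<Rightarrow> 'a pref \<Rightarrow> bool" where
  "ambiguity_neutral F R \<longleftrightarrow>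
     (\<forall>A\<in>sets F. \<forall>B\<in>sets F. \<forall>C\<in>sets F. (A \<union> B) \<inter> C = {} \<longrightarrow>
        (event_pref R A B \<longleftrightarrow> event_pref R (A \<union> C) (B \<union> C)))"

text \<open>
  Nonnegativity is stated separately because \<open>ennreal\<close> maps negative reals to \<open>0\<close>.
\<close>

definition probability_on :: "'a measure \<Rightarrow> ('a set \<Rightarrow> real) \<Rightarrow> bool" where
  "probability_on F \<nu> \<longleftrightarrow>
     (\<forall>A\<in>sets F. 0 \<le> \<nu> A) \<and> \<nu> (space F) = 1 \<and>
     measure_space (space F) (sets F) (\<lambda>A. ennreal (\<nu> A))"

end

theory Submission
  imports Defs
begin

text \<open>
  Axioms (RC), (M), (SRM) and atomlessness make \<open>\<P>\<close> represent the preference on \<open>\<G>\<close>-events, so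
  the matching probability represents it on all of \<open>\<F>\<close>; if it is additive, (AN) is immediate.
  Conversely, (AN) lets one add indifferent disjoint events. Since \<open>\<nu>\<close> respects complements,
  \<open>\<nu> B \<le> 1 - \<nu> A\<close> for disjoint \<open>A, B\<close>, so by atomlessness the two events have disjoint
  matching \<open>\<G>\<close>-events, whence \<open>\<nu>\<close> is finitely additive. For countable additivity, an event
  \<open>D \<in> \<G>\<close> of probability \<open>\<Sum>n. \<nu> (A n)\<close> is weakly preferred to every finite union of the
  \<open>A n\<close>, hence by (C) to the whole union.
\<close>

section \<open>Atomless measures, B-closed sets and indicator acts\<close>

lemma atomlessE:
  assumes "atomless M" and "A \<in> sets M" and "0 \<le> r" and "r \<le> measure M A"
  obtains B where "B \<in> sets M" and "B \<subseteq> A" and "measure M B = r"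
proof -
  have "r \<in> {measure M B | B. B \<in> sets M \<and> B \<subseteq> A}"
    using assms unfolding atomless_def by auto
  then show ?thesis using that by auto
qed

lemma B_closedD:
  assumes "B_closed F S" and "\<And>n::nat. Xs n \<in> S" and "bounded (\<Union>n. Xs n ` space F)"
    and "X \<in> acts F" and "\<And>\<omega>. \<omega> \<in> space F \<Longrightarrow> (\<lambda>n. Xs n \<omega>) \<longlonglongrightarrow> X \<omega>"
  shows "X \<in> S"
  using assms(1)[unfolded B_closed_def, rule_format, of Xs X] assms(2-) by simp

lemma indicator_in_acts: "A \<in> sets M \<Longrightarrow> indicat_real A \<in> acts M"
  unfolding acts_def bounded_iff by (auto intro!: exI[of _ 1] simp: indicator_def)

locale risk_consistent_preference = P: prob_space P for P :: "'a measure" +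
  fixes F :: "'a measure" and R :: "'a pref" and \<nu> :: "'a set \<Rightarrow> real"
  assumes subalg: "subalgebra F P"
    and atomless: "atomless P"
    and preference: "preference F R"
    and RC: "axiom_RC P R"
    and M: "axiom_M F R"
    and SRM: "axiom_SRM P R"
    and C: "axiom_C F R"
    and matching: "matching_probability F P R \<nu>"
begin

section \<open>Representation of the preference on events\<close>

lemma space_eq: "space F = space P"
  and sets_subset: "A \<in> sets P \<Longrightarrow> A \<in> sets F"
  using subalg by (auto simp: subalgebra_def)

lemma event_pref_trans:
  assumes "event_pref R A B" "event_pref R B C" "A \<in> sets F" "B \<in> sets F" "C \<in> sets F"
  shows "event_pref R A C"
proof -
  have "transp_on (acts F) R" using preference by (simp add: preference_def)
  from transp_onD[OF this assms(3-5)[THEN indicator_in_acts]] show ?thesis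
    using assms(1,2) by (simp add: event_pref_def)
qed

lemma event_pref_mono:
  assumes "B \<subseteq> A" "A \<in> sets F" "B \<in> sets F"
  shows "event_pref R A B"
proof -
  have "\<forall>\<omega>\<in>space F. indicat_real A \<omega> \<ge> indicat_real B \<omega>"
    using assms(1) by (auto simp: indicator_def)
  then show ?thesis
    using M assms(2,3)[THEN indicator_in_acts] by (auto simp: axiom_M_def event_pref_def)
qed

text \<open>(RC) compares the functions \<open>x \<mapsto> \<P>(X > x)\<close>. For the indicator of
  \<open>D\<close> this is 1 for \<open>x < 0\<close>, \<open>measure P D\<close> on
  \<open>[0, 1)\<close> and 0 from 1 on, so it depends on \<open>D\<close> only through its
  probability.\<close>

lemma event_pref_if_measure_eq:
  assumes "A \<in> sets P" "B \<in> sets P" "measure P A = measure P B"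
  shows "event_pref R A B"
proof -
  have *: "{\<omega> \<in> space P. x < indicat_real D \<omega>} = (if x < 0 then space P else if x < 1 then D else {})"
    if "D \<in> sets P" for D x
    using sets.sets_into_space[OF that] by (auto simp: indicator_def)
  have "\<forall>x. \<P>(\<omega> in P. indicat_real A \<omega> > x) = \<P>(\<omega> in P. indicat_real B \<omega> > x)"
    using assms by (simp add: *)
  then have "indiff R (indicat_real A) (indicat_real B)"
    using RC assms(1,2)[THEN indicator_in_acts] unfolding axiom_RC_def by blast
  then show ?thesis by (simp add: indiff_def event_pref_def)
qed

text \<open>Atomlessness places a copy of the less probable event inside the more probable one. (RC)
  makes event and copy indifferent, and inclusion brings in (M) for the weak comparison and (SRM)
  for the strict one.\<close>

lemma event_pref_iff_measure_le:
  assumes A: "A \<in> sets P" and B: "B \<in> sets P"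
  shows "event_pref R A B \<longleftrightarrow> measure P B \<le> measure P A"
proof
  assume le: "measure P B \<le> measure P A"
  obtain B' where B': "B' \<in> sets P" "B' \<subseteq> A" "measure P B' = measure P B"
    using atomlessE[OF atomless A _ le] by auto
  have "event_pref R A B'" using A B' by (intro event_pref_mono sets_subset)
  moreover have "event_pref R B' B" using B B' by (intro event_pref_if_measure_eq) auto
  ultimately show "event_pref R A B"
    by (rule event_pref_trans) (use A B B'(1) sets_subset in auto)
next
  assume pref: "event_pref R A B"
  show "measure P B \<le> measure P A"
  proof (rule ccontr)
    assume "\<not> measure P B \<le> measure P A"
    then have less: "measure P A < measure P B" by simp
    obtain A' where A': "A' \<in> sets P" "A' \<subseteq> B" "measure P A' = measure P A"
      using atomlessE[OF atomless B _ less_imp_le[OF less]] by auto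
    \<comment> \<open>The indicator of \<open>B\<close> dominates that of \<open>A'\<close>
      everywhere, strictly on \<open>B - A'\<close>, whose probability
      \<open>measure P B - measure P A\<close> is positive. These are the two premises of
      (SRM).\<close>
    have "{\<omega> \<in> space P. indicat_real A' \<omega> < indicat_real B \<omega>} = B - A'"
      using sets.sets_into_space[OF B] A'(2) by (auto simp: indicator_def)
    then have "\<P>(\<omega> in P. indicat_real B \<omega> > indicat_real A' \<omega>) > 0"
      using less A' B by (simp add: P.finite_measure_Diff)
    moreover have "{\<omega> \<in> space P. indicat_real A' \<omega> \<le> indicat_real B \<omega>} = space P"
      using A'(2) by (auto simp: indicator_def)
    then have "\<P>(\<omega> in P. indicat_real B \<omega> \<ge> indicat_real A' \<omega>) = 1"
      by (simp add: P.prob_space)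
    ultimately have "\<not> event_pref R A' B"
      using SRM A'(1)[THEN indicator_in_acts] B[THEN indicator_in_acts]
      unfolding axiom_SRM_def strict_pref_def event_pref_def by blast
    moreover have "event_pref R A' A" using A A' by (intro event_pref_if_measure_eq)
    moreover have "event_pref R A' B"
      by (rule event_pref_trans[OF \<open>event_pref R A' A\<close> pref]) (use A B A'(1) sets_subset in auto)
    ultimately show False by blast
  qed
qed

lemma matching_eventE:
  assumes "A \<in> sets F"
  obtains A' where "A' \<in> sets P" "measure P A' = \<nu> A" "event_pref R A A'" "event_pref R A' A"
  using matching assms
  unfolding matching_probability_def event_indiff_def indiff_def event_pref_def by metis

text \<open>Replacing both events by their matching events in \<G> preserves the comparison by
  transitivity, and on \<G> the probability decides it.\<close>

lemma event_pref_iff: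
  assumes A: "A \<in> sets F" and B: "B \<in> sets F"
  shows "event_pref R A B \<longleftrightarrow> \<nu> B \<le> \<nu> A"
proof -
  obtain A' where A': "A' \<in> sets P" "measure P A' = \<nu> A" "event_pref R A A'" "event_pref R A' A"
    using matching_eventE[OF A] .
  obtain B' where B': "B' \<in> sets P" "measure P B' = \<nu> B" "event_pref R B B'" "event_pref R B' B"
    using matching_eventE[OF B] .
  have "event_pref R A B \<longleftrightarrow> event_pref R A' B'"
    using event_pref_trans[of A' A B] event_pref_trans[of A' B B'] event_pref_trans[of A A' B']
      event_pref_trans[of A B' B] A' B' A B sets_subset by auto
  then show ?thesis using event_pref_iff_measure_le A' B' by simp
qed

text \<open>An event of \<G> and its matching event both lie in \<G>, where indifference forces
  equal probabilities. Thus \<nu> extends the given probability.\<close>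

lemma matching_eq_measure:
  assumes A: "A \<in> sets P" shows "\<nu> A = measure P A"
proof -
  obtain A' where A': "A' \<in> sets P" "measure P A' = \<nu> A" "event_pref R A A'" "event_pref R A' A"
    using matching_eventE[OF sets_subset[OF A]] .
  then show ?thesis using event_pref_iff_measure_le A by fastforce
qed

lemma matching_nonneg: "A \<in> sets F \<Longrightarrow> 0 \<le> \<nu> A"
  and matching_le_1: "A \<in> sets F \<Longrightarrow> \<nu> A \<le> 1"
  using matching by (auto simp: matching_probability_def)

lemma matching_mono:
  assumes "B \<subseteq> A" "A \<in> sets F" "B \<in> sets F" shows "\<nu> B \<le> \<nu> A"
  using event_pref_mono[OF assms] event_pref_iff[OF assms(2,3)] by simp

text \<open>Both directions of the equivalence use (AN) only in this form, which speaks of \<nu>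
  alone.\<close>

lemma ambiguity_neutral_iff:
  "ambiguity_neutral F R \<longleftrightarrow>
     (\<forall>A\<in>sets F. \<forall>B\<in>sets F. \<forall>C\<in>sets F. (A \<union> B) \<inter> C = {} \<longrightarrow>
        (\<nu> B \<le> \<nu> A \<longleftrightarrow> \<nu> (B \<union> C) \<le> \<nu> (A \<union> C)))"
  unfolding ambiguity_neutral_def by (simp add: event_pref_iff)

section \<open>From ambiguity neutrality to countable additivity\<close>

context
  assumes AN: "ambiguity_neutral F R"
begin

lemma matching_Un_le_iff:
  assumes "A \<in> sets F" "B \<in> sets F" "C \<in> sets F" "A \<inter> C = {}" "B \<inter> C = {}"
  shows "\<nu> (A \<union> C) \<le> \<nu> (B \<union> C) \<longleftrightarrow> \<nu> A \<le> \<nu> B"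
proof -
  have "(B \<union> A) \<inter> C = {}" using assms(4,5) by blast
  then show ?thesis using AN assms(1-3) unfolding ambiguity_neutral_iff by blast
qed

text \<open>Replacing \<open>A'\<close> by \<open>A\<close> and then \<open>B'\<close> by
  \<open>B\<close> would fail where \<open>A'\<close> meets \<open>B\<close>. So
  \<open>B - A'\<close> is added to the first comparison and \<open>A' - B\<close> to the second.
  Both then contain the event \<open>A' \<union> B\<close> and can be chained; adding
  \<open>A' \<inter> B\<close>, which is disjoint from both ends of the chain, completes the
  unions.\<close>

lemma matching_Un_mono:
  assumes S: "A \<in> sets F" "B \<in> sets F" "A' \<in> sets F" "B' \<in> sets F"
    and D: "A \<inter> B = {}" "A' \<inter> B' = {}" and le: "\<nu> A' \<le> \<nu> A" "\<nu> B' \<le> \<nu> B"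
  shows "\<nu> (A' \<union> B') \<le> \<nu> (A \<union> B)"
proof -
  have "\<nu> (A' \<union> (B - A')) \<le> \<nu> (A \<union> (B - A'))"
    using matching_Un_le_iff[of A' A "B - A'"] S D le by blast
  moreover have "\<nu> (B' \<union> (A' - B)) \<le> \<nu> (B \<union> (A' - B))"
    using matching_Un_le_iff[of B' B "A' - B"] S D le by blast
  moreover have "A' \<union> (B - A') = B \<union> (A' - B)" by blast
  ultimately have "\<nu> (B' \<union> (A' - B)) \<le> \<nu> (A \<union> (B - A'))" by simp
  then have "\<nu> (B' \<union> (A' - B) \<union> (A' \<inter> B)) \<le> \<nu> (A \<union> (B - A') \<union> (A' \<inter> B))"
    using matching_Un_le_iff[of "B' \<union> (A' - B)" "A \<union> (B - A')" "A' \<inter> B"] S D by blast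
  moreover have "B' \<union> (A' - B) \<union> (A' \<inter> B) = A' \<union> B'" "A \<union> (B - A') \<union> (A' \<inter> B) = A \<union> B"
    by blast+
  ultimately show ?thesis by simp
qed

lemma matching_Un_cong:
  assumes "A \<in> sets F" "B \<in> sets F" "A' \<in> sets F" "B' \<in> sets F"
    and "A \<inter> B = {}" "A' \<inter> B' = {}" "\<nu> A = \<nu> A'" "\<nu> B = \<nu> B'"
  shows "\<nu> (A \<union> B) = \<nu> (A' \<union> B')"
  using matching_Un_mono[of A B A' B'] matching_Un_mono[of A' B' A B] assms by simp

text \<open>Cancelling the common part \<open>A \<inter> B\<close> leaves the two differences.
  Adding the complement of \<open>A \<union> B\<close> turns them into the complements, in reversed
  order.\<close>

lemma matching_compl_mono:
  assumes S: "A \<in> sets F" "B \<in> sets F" and le: "\<nu> A \<le> \<nu> B"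
  shows "\<nu> (space F - B) \<le> \<nu> (space F - A)"
proof -
  let ?C = "space F - (A \<union> B)"
  have "(A - B) \<union> (A \<inter> B) = A" "(B - A) \<union> (A \<inter> B) = B" by blast+
  moreover have "(A - B) \<inter> (A \<inter> B) = {}" "(B - A) \<inter> (A \<inter> B) = {}" by blast+
  ultimately have "\<nu> (A - B) \<le> \<nu> (B - A)"
    using matching_Un_le_iff[of "A - B" "B - A" "A \<inter> B"] S le by simp
  then have "\<nu> ((A - B) \<union> ?C) \<le> \<nu> ((B - A) \<union> ?C)"
    using matching_Un_le_iff[of "A - B" "B - A" ?C] S by blast
  moreover have "(A - B) \<union> ?C = space F - B" "(B - A) \<union> ?C = space F - A"
    using S[THEN sets.sets_into_space] by blast+
  ultimately show ?thesis by simp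
qed

text \<open>The complement of \<open>A\<close> is compared with that of a matching event in \<G>,
  where \<nu> is a probability.\<close>

lemma matching_compl_le:
  assumes A: "A \<in> sets F"
  shows "\<nu> (space F - A) \<le> 1 - \<nu> A"
proof -
  obtain A' where A': "A' \<in> sets P" "measure P A' = \<nu> A"
    using matching_eventE[OF A] by blast
  have "\<nu> (space F - A) \<le> \<nu> (space F - A')"
    using matching_compl_mono[of A' A] A A' sets_subset matching_eq_measure by simp
  also have "\<dots> = 1 - \<nu> A"
    using A' P.prob_compl[OF A'(1)] by (simp add: matching_eq_measure space_eq)
  finally show ?thesis .
qed

lemma matching_Un:
  assumes A: "A \<in> sets F" and B: "B \<in> sets F" and D: "A \<inter> B = {}"
  shows "\<nu> (A \<union> B) = \<nu> A + \<nu> B"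
proof -
  obtain A' where A': "A' \<in> sets P" "measure P A' = \<nu> A"
    using matching_eventE[OF A] by blast
  \<comment> \<open>Disjointness puts \<open>B\<close> inside the complement of \<open>A\<close>, so
    the complement of \<open>A'\<close> is probable enough to contain a matching event for
    \<open>B\<close>.\<close>
  have "\<nu> B \<le> \<nu> (space F - A)"
    using matching_mono[of B "space F - A"] A B D sets.sets_into_space[OF B] by blast
  also have "\<dots> \<le> measure P (space P - A')"
    using matching_compl_le[OF A] P.prob_compl[OF A'(1)] A'(2) by simp
  finally obtain B' where B': "B' \<in> sets P" "B' \<subseteq> space P - A'" "measure P B' = \<nu> B"
    using atomlessE[OF atomless _ matching_nonneg[OF B], of "space P - A'"] A'(1) by auto
  have "\<nu> (A \<union> B) = \<nu> (A' \<union> B')"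
    using A B A' B' D by (intro matching_Un_cong) (auto simp: matching_eq_measure sets_subset)
  also have "\<dots> = measure P A' + measure P B'"
    using A' B' by (subst P.finite_measure_Union[symmetric]) (auto simp: matching_eq_measure)
  finally show ?thesis using A' B' by simp
qed

lemma matching_sum:
  fixes A :: "nat \<Rightarrow> 'a set"
  assumes A: "range A \<subseteq> sets F" and D: "disjoint_family A"
  shows "\<nu> (\<Union>i<n. A i) = (\<Sum>i<n. \<nu> (A i))"
proof (induction n)
  case 0
  then show ?case by (simp add: matching_eq_measure)
next
  case (Suc n)
  have "A n \<inter> A i = {}" if "i < n" for i
    using that by (intro disjoint_family_onD[OF D]) auto
  then have "A n \<inter> (\<Union>i<n. A i) = {}" by auto
  moreover have "(\<Union>i<n. A i) \<in> sets F" using A by auto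
  ultimately have "\<nu> (A n \<union> (\<Union>i<n. A i)) = \<nu> (A n) + \<nu> (\<Union>i<n. A i)"
    using A by (intro matching_Un) auto
  then show ?case using Suc by (simp add: lessThan_Suc)
qed

lemma matching_sums:
  fixes A :: "nat \<Rightarrow> 'a set"
  assumes A: "range A \<subseteq> sets F" and D: "disjoint_family A"
  shows "(\<lambda>i. \<nu> (A i)) sums \<nu> (\<Union>i. A i)"
proof -
  have A_sets: "A i \<in> sets F" for i using A by auto
  have partial_sets: "(\<Union>i<n. A i) \<in> sets F" for n using A_sets by auto
  have union_sets: "(\<Union>i. A i) \<in> sets F" using A_sets by auto
  have partial_le: "(\<Sum>i<n. \<nu> (A i)) \<le> \<nu> (\<Union>i. A i)" for n
    unfolding matching_sum[OF A D, symmetric]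
    using matching_mono[OF _ union_sets partial_sets] by blast
  \<comment> \<open>The summability criterion bounds sums over \<open>{..n}\<close>, while
    \<open>partial_le\<close> bounds those over \<open>{..<n}\<close>. Hence the rewriting to
    \<open>{..<Suc n}\<close>, which must not be split again.\<close>
  have summable: "summable (\<lambda>i. \<nu> (A i))"
    using A_sets partial_le
    by (intro bounded_imp_summable[where B = "\<nu> (\<Union>i. A i)"])
       (auto intro: matching_nonneg simp: lessThan_Suc_atMost[symmetric] simp del: sum.lessThan_Suc)
  define s where "s = (\<Sum>i. \<nu> (A i))"
  have s_le: "s \<le> \<nu> (\<Union>i. A i)"
    unfolding s_def using summable partial_le by (rule suminf_le_const)
  have "s \<ge> 0" unfolding s_def using summable A_sets by (intro suminf_nonneg matching_nonneg)
  moreover have "s \<le> measure P (space P)"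
    using s_le matching_le_1[OF union_sets] by (simp add: P.prob_space)
  \<comment> \<open>Such an event exists because \<open>s\<close> lies between 0 and 1. The event
    \<open>D\<close> is unrelated to the fact \<open>D\<close>, which still states that the family
    is disjoint.\<close>
  ultimately obtain D where D_P: "D \<in> sets P" and D_s: "measure P D = s"
    using atomlessE[OF atomless sets.top] by metis
  then have D_F: "D \<in> sets F" and \<nu>D: "\<nu> D = s"
    using sets_subset matching_eq_measure by auto
  have "event_pref R D (\<Union>i<n. A i)" for n
    using event_pref_iff[OF D_F partial_sets] matching_sum[OF A D]
      sum_le_suminf[OF summable, of "{..<n}"] A_sets matching_nonneg
    by (simp add: \<nu>D s_def)
  then have pref: "indicat_real (\<Union>i<n. A i) \<in> {Y \<in> acts F. R (indicat_real D) Y}" for n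
    using indicator_in_acts[OF partial_sets] by (simp add: event_pref_def)
  have bounded: "bounded (\<Union>n. indicat_real (\<Union>i<n. A i) ` space F)"
    unfolding bounded_iff by (auto intro!: exI[of _ 1] simp: indicator_def)
  have "B_closed F {Y \<in> acts F. R (indicat_real D) Y}"
    using C indicator_in_acts[OF D_F] by (simp add: axiom_C_def)
  \<comment> \<open>The indicators of the finite unions are bounded by 1 and converge pointwise to
    that of the whole union, so (C) passes the comparison to the limit.\<close>
  then have "indicat_real (\<Union>i. A i) \<in> {Y \<in> acts F. R (indicat_real D) Y}"
    by (rule B_closedD[OF _ pref bounded indicator_in_acts[OF union_sets] LIMSEQ_indicator_UN])
  then have "\<nu> (\<Union>i. A i) \<le> s"
    using event_pref_iff[OF D_F union_sets] \<nu>D by (simp add: event_pref_def)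
  then show ?thesis using s_le summable by (simp add: sums_iff s_def)
qed

lemma probability_on_if_ambiguity_neutral: "probability_on F \<nu>"
proof -
  have "\<nu> (space F) = 1"
    using matching_eq_measure[OF sets.top] by (simp add: space_eq P.prob_space)
  moreover have "countably_additive (sets F) (\<lambda>A. ennreal (\<nu> A))"
  proof (rule countably_additiveI)
    fix A :: "nat \<Rightarrow> 'a set"
    assume A: "range A \<subseteq> sets F" "disjoint_family A"
    then have "(\<lambda>i. \<nu> (A i)) sums \<nu> (\<Union>i. A i)" by (rule matching_sums)
    then show "(\<Sum>i. ennreal (\<nu> (A i))) = ennreal (\<nu> (\<Union>i. A i))"
      using A by (intro suminf_ennreal_eq) (auto intro: matching_nonneg)
  qed
  moreover have "positive (sets F) (\<lambda>A. ennreal (\<nu> A))"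
    by (simp add: positive_def matching_eq_measure)
  ultimately show ?thesis
    using matching_nonneg by (simp add: probability_on_def measure_space_def sets.sigma_algebra_axioms)
qed

end

section \<open>From additivity to ambiguity neutrality\<close>

lemma ambiguity_neutral_if_probability_on:
  assumes prob: "probability_on F \<nu>"
  shows "ambiguity_neutral F R"
proof -
  have ca: "countably_additive (sets F) (\<lambda>A. ennreal (\<nu> A))"
    and pos: "positive (sets F) (\<lambda>A. ennreal (\<nu> A))"
    using prob by (auto simp: probability_on_def measure_space_def)
  have "\<nu> (A \<union> B) = \<nu> A + \<nu> B" if "A \<in> sets F" "B \<in> sets F" "A \<inter> B = {}" for A B
  proof -
    have "ennreal (\<nu> (A \<union> B)) = ennreal (\<nu> A) + ennreal (\<nu> B)"
      using sets.countably_additive_additive[OF pos ca] that by (simp add: additive_def)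
    \<comment> \<open>Nonnegativity of \<nu> lets the identity in \<open>ennreal\<close> be read off
      in the reals.\<close>
    then show ?thesis
      using that by (simp add: matching_nonneg flip: ennreal_plus)
  qed
  then show ?thesis
    \<comment> \<open>The hypothesis splits into disjointness of \<open>C\<close> from
      \<open>A\<close> and from \<open>B\<close>; then \<open>\<nu> C\<close> cancels on both
      sides.\<close>
    unfolding ambiguity_neutral_iff by (simp add: Int_Un_distrib2)
qed

end

theorem theorem3:
  fixes F P :: "'a measure"
    and R :: "('a \<Rightarrow> real) \<Rightarrow> ('a \<Rightarrow> real) \<Rightarrow> bool"
    and \<nu> :: "'a set \<Rightarrow> real"
  assumes "prob_space P"
    and "subalgebra F P"
    and "atomless P"
    and "preference F R"
    and "axiom_RC P R"
    and "axiom_M F R"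
    and "axiom_SRM P R"
    and "axiom_C F R"
    and "matching_probability F P R \<nu>"
  shows "ambiguity_neutral F R \<longleftrightarrow> probability_on F \<nu>"
proof -
  interpret risk_consistent_preference P F R \<nu>
    using assms by (intro risk_consistent_preference.intro risk_consistent_preference_axioms.intro)
  show ?thesis
    using probability_on_if_ambiguity_neutral ambiguity_neutral_if_probability_on by blast
qed

end
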